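(* There exist a set $P\subset\mathbb{R}^2$ of exactly $10$ points and a triangle $T\subset\mathbb{R}^2$ such that for every coloring of the points of $P$ with two colors there exists a translate of $T$ that contains exactly $3$ points of $P$, all three of the same color.
   Context: A triangle is a nondegenerate triangular region in the plane: the convex hull of three non-collinear points (closed triangle) or its interior (open triangle). *)

theory Defs
  imports "HOL-Analysis.Analysis"
begin

definition closed_triangle :: "(real^2) set \<Rightarrow> bool" where
  "closed_triangle T \<longleftrightarrow> (\<exists>a b c. \<not> collinear {a, b, c} \<and> T = convex hull {a, b, c})"

definition open_triangle :: "(real^2) set \<Rightarrow> bool" where
  "open_triangle T \<longleftrightarrow> (\<exists>S. closed_triangle S \<and> T = interior S)"

definition plane_triangle :: "(real^2) set \<Rightarrow> bool" where
  "plane_triangle T \<longleftrightarrow> closed_triangle T \<or> open_triangle T"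

end

theory Submission imports Defs
begin

text \<open>
  Write \<open>A = (5,6)\<close>, \<open>B = (0,6)\<close>, \<open>C = (3,5)\<close>, \<open>D = (4,6)\<close>, \<open>E = (5,2)\<close>, \<open>G = (5,0)\<close>,
  \<open>H = (1,3)\<close>, \<open>I = (2,1)\<close>, \<open>J = (5,4)\<close>. Integer translates of the closed triangle with vertices
  \<open>(0,0)\<close>, \<open>(5,0)\<close>, \<open>(0,5)\<close> cut the triples GHI, BEH, BCJ, CEH, CHJ, ACD, CEI, CEG, DEJ, AEJ out
  of these points and the tenth point \<open>(6,6)\<close>. Suppose none of the triples is monochromatic.
  If C and E have the same colour, then G, H and I all have the other one, so GHI is monochromatic.
  If C and E differ, then J has the colour of E: either H is coloured like C, and CHJ applies,
  or H is coloured like E, so B is coloured like C by BEH, and BCJ applies. Hence A and D are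
  coloured like C, and ACD is monochromatic. The configuration was found by a computer search.
\<close>

text \<open>Integer pairs keep the finite case checks in exact integer arithmetic.\<close>

definition lattice_point :: "int \<times> int \<Rightarrow> real^2" where
  "lattice_point q = vector [of_int (fst q), of_int (snd q)]"

lemma lattice_point_nth [simp]:
  "lattice_point q $ 1 = of_int (fst q)" "lattice_point q $ 2 = of_int (snd q)"
  by (simp_all add: lattice_point_def)

lemma inj_lattice_point: "inj lattice_point"
proof (rule injI)
  fix p q assume "lattice_point p = lattice_point q"
  then have "lattice_point p $ i = lattice_point q $ i" for i by simp
  from this[of 1] this[of 2] show "p = q" by (simp add: prod_eq_iff)
qed

text \<open>Linear inequalities, rather than a hull, make membership in a translate an arithmetic
  condition.\<close>

definition right_triangle :: "real \<Rightarrow> (real^2) set" where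
  "right_triangle s = {p. 0 \<le> p $ 1 \<and> 0 \<le> p $ 2 \<and> p $ 1 + p $ 2 \<le> s}"

lemma right_triangle_eq_hull:
  assumes "s > 0"
  shows "right_triangle s = convex hull {0, vector [s, 0], vector [0, s]}"
proof (intro set_eqI iffI)
  fix p :: "real^2"
  assume p: "p \<in> right_triangle s"
  \<comment> \<open>Barycentric weights of \<open>p\<close> at the two nonzero vertices.\<close>
  let ?u = "p $ 1 / s" and ?v = "p $ 2 / s"
  have "p = (1 - ?u - ?v) *\<^sub>R 0 + ?u *\<^sub>R vector [s, 0] + ?v *\<^sub>R vector [0, s]"
    using assms by (simp add: vec_eq_iff forall_2)
  moreover have "0 \<le> ?u" "0 \<le> ?v" using p assms by (auto simp: right_triangle_def)
  moreover have "?u + ?v \<le> 1"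
    using p assms by (simp add: right_triangle_def flip: add_divide_distrib)
  ultimately show "p \<in> convex hull {0, vector [s, 0], vector [0, s]}"
    unfolding convex_hull_3 mem_Collect_eq
    by (intro exI[of _ "1 - ?u - ?v"] exI[of _ ?u] exI[of _ ?v]) simp
next
  fix p :: "real^2"
  assume "p \<in> convex hull {0, vector [s, 0], vector [0, s]}"
  then obtain u v w :: real where "0 \<le> u" "0 \<le> v" "0 \<le> w" and sum: "u + v + w = 1"
    and p: "p = u *\<^sub>R 0 + v *\<^sub>R vector [s, 0] + w *\<^sub>R vector [0, s]"
    unfolding convex_hull_3 by blast
  moreover have "(v + w) * s \<le> 1 * s"
    using \<open>0 \<le> u\<close> sum assms by (intro mult_right_mono) auto
  ultimately show "p \<in> right_triangle s"
    using assms by (simp add: right_triangle_def algebra_simps)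
qed

lemma closed_triangle_right_triangle:
  assumes "s > 0"
  shows "closed_triangle (right_triangle s)"
proof -
  have "\<not> collinear {0, vector [s, 0], vector [0, s] :: real^2}"
    using assms by (auto simp: collinear_lemma vec_eq_iff forall_2)
  then show ?thesis
    unfolding closed_triangle_def right_triangle_eq_hull[OF assms] by blast
qed

lemma lattice_point_in_translate:
  "lattice_point p \<in> (+) (lattice_point v) ` right_triangle (of_int s) \<longleftrightarrow>
    fst v \<le> fst p \<and> snd v \<le> snd p \<and> fst p + snd p \<le> fst v + snd v + s"
proof -
  have "lattice_point p \<in> (+) (lattice_point v) ` right_triangle (of_int s) \<longleftrightarrow>
      lattice_point p - lattice_point v \<in> right_triangle (of_int s)"
    by (force simp: image_iff)
  also have "\<dots> \<longleftrightarrow> fst v \<le> fst p \<and> snd v \<le> snd p \<and> fst p + snd p \<le> fst v + snd v + s"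
    unfolding right_triangle_def mem_Collect_eq by simp linarith
  finally show ?thesis .
qed

lemma lattice_points_Int_translate:
  "lattice_point ` Q \<inter> (+) (lattice_point v) ` right_triangle (of_int s) =
    lattice_point ` {p \<in> Q. fst v \<le> fst p \<and> snd v \<le> snd p \<and> fst p + snd p \<le> fst v + snd v + s}"
  using lattice_point_in_translate by blast

text \<open>The point (6,6) brings the count to ten and spoils no triple: its coordinate sum 12
  exceeds \<open>a + b + 5\<close>, which is at most 11 for the ten cuts used.\<close>

definition config :: "(int \<times> int) set" where
  "config = {(5,6), (0,6), (3,5), (4,6), (5,2), (6,6), (5,0), (1,3), (2,1), (5,4)}"

lemma config_translate_monochromatic:
  fixes color :: "int \<times> int \<Rightarrow> bool"
  obtains a b k where
    "card {p \<in> config. a \<le> fst p \<and> b \<le> snd p \<and> fst p + snd p \<le> a + b + 5} = 3"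
    "\<forall>p \<in> {p \<in> config. a \<le> fst p \<and> b \<le> snd p \<and> fst p + snd p \<le> a + b + 5}. color p = k"
proof -
  define cut where
    "cut a b = {p \<in> config. a \<le> fst p \<and> b \<le> snd p \<and> fst p + snd p \<le> a + b + 5}" for a b
  have cuts:
    "cut 0 0 = {(5,0), (1,3), (2,1)}" "cut 0 2 = {(0,6), (5,2), (1,3)}"
    "cut 0 4 = {(0,6), (3,5), (5,4)}" "cut 1 2 = {(3,5), (5,2), (1,3)}"
    "cut 1 3 = {(3,5), (1,3), (5,4)}" "cut 1 5 = {(5,6), (3,5), (4,6)}"
    "cut 2 1 = {(3,5), (5,2), (2,1)}" "cut 3 0 = {(3,5), (5,2), (5,0)}"
    "cut 4 1 = {(4,6), (5,2), (5,4)}" "cut 5 1 = {(5,6), (5,2), (5,4)}"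
    by (auto simp: cut_def config_def)
  have "\<exists>a b k. card (cut a b) = 3 \<and> (\<forall>p \<in> cut a b. color p = k)"
  proof (rule ccontr)
    assume "\<not> ?thesis"
    then have no: "\<not> (\<forall>p \<in> cut a b. color p = k)" if "card (cut a b) = 3" for a b k
      using that by blast
    note bad = no[of 0 0] no[of 0 2] no[of 0 4] no[of 1 2] no[of 1 3]
      no[of 1 5] no[of 2 1] no[of 3 0] no[of 4 1] no[of 5 1]
    \<comment> \<open>With both values of \<open>k\<close>, the triples become twenty clauses in the
      colours of nine points, which are propositionally unsatisfiable.\<close>
    show False
      using bad[where k = True] bad[where k = False] unfolding cuts by simp argo
  qed
  then show thesis using that unfolding cut_def by blast
qed

theorem claim12:
  "\<exists>(P :: (real^2) set) (T :: (real^2) set).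
     finite P \<and> card P = 10 \<and> plane_triangle T \<and>
     (\<forall>color :: real^2 \<Rightarrow> bool. \<exists>v :: real^2.
        card (P \<inter> (+) v ` T) = 3 \<and>
        (\<exists>k. \<forall>p \<in> P \<inter> (+) v ` T. color p = k))"
proof -
  let ?P = "lattice_point ` config" and ?T = "right_triangle (of_int 5)"
  have card_image_lattice: "card (lattice_point ` Q) = card Q" for Q
    by (rule card_image[OF inj_on_subset[OF inj_lattice_point subset_UNIV]])
  have "\<exists>v. card (?P \<inter> (+) v ` ?T) = 3 \<and> (\<exists>k. \<forall>p \<in> ?P \<inter> (+) v ` ?T. color p = k)"
    for color :: "real^2 \<Rightarrow> bool"
  proof -
    \<comment> \<open>The colouring is pulled back to integer pairs; injectivity of
      \<open>lattice_point\<close> preserves the count of three.\<close>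
    obtain a b k where
      "card {p \<in> config. a \<le> fst p \<and> b \<le> snd p \<and> fst p + snd p \<le> a + b + 5} = 3"
      "\<forall>p \<in> {p \<in> config. a \<le> fst p \<and> b \<le> snd p \<and> fst p + snd p \<le> a + b + 5}.
        (color \<circ> lattice_point) p = k"
      by (rule config_translate_monochromatic)
    then have "card (?P \<inter> (+) (lattice_point (a, b)) ` ?T) = 3 \<and>
        (\<forall>p \<in> ?P \<inter> (+) (lattice_point (a, b)) ` ?T. color p = k)"
      unfolding lattice_points_Int_translate card_image_lattice by simp
    then show ?thesis by blast
  qed
  moreover have "finite ?P" "card ?P = 10"
    unfolding card_image_lattice by (simp_all add: config_def)
  moreover have "plane_triangle ?T"
    unfolding plane_triangle_def by (simp add: closed_triangle_right_triangle)
  ultimately show ?thesis by blast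
qed

end
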